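(* Consider an instance of the multiplicative assignment problem with upgrades in which the values $b_i$ ($i\in I$) and $c_i$ ($i\in I$) are all pairwise different and the demands $d_j$ ($j\in J$) are pairwise different. Then every vertex of $P(k)$ that is an optimal solution of the linear program (minimizing $\sum_{(i,j)\in I\times J} b_i d_j x_{i,j} + c_i d_j y_{i,j}$ over $P(k)$) is integral.
   Context: An instance of the multiplicative assignment problem with upgrades consists of finite sets $I$ (suppliers) and $J$ (customers) with $|I|=|J|$, numbers $0\le b_i\le c_i$ for each $i\in I$, demands $d_j\ge 0$ for each $j\in J$, and an integer $k\in\{0,\dots,|I|\}$. The polytope $P(k)$ is the set of all $(x,y)\in\mathbb{R}^{I\times J}\times\mathbb{R}^{I\times J}$ satisfying $\sum_{i\in I}(x_{i,j}+y_{i,j})=1$ for all $j\in J$, $\sum_{j\in J}(x_{i,j}+y_{i,j})=1$ for all $i\in I$, $\sum_{(i,j)\in I\times J}x_{i,j}\le k$, and $x_{i,j}\ge 0$, $y_{i,j}\ge 0$ for all $(i,j)$. *)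

theory Defs
  imports "HOL-Analysis.Analysis"
begin

text \<open>The supplier set is the finite type \<open>'i\<close>, the customer set the finite type \<open>'j\<close>,
  so that \<open>real ^ ('i \<times> 'j)\<close> is the space of real vectors indexed by pairs (supplier, customer).\<close>

definition mapu_instance ::
  "('i::finite \<Rightarrow> real) \<Rightarrow> ('i \<Rightarrow> real) \<Rightarrow> ('j::finite \<Rightarrow> real) \<Rightarrow> nat \<Rightarrow> bool" where
  "mapu_instance b c d k \<longleftrightarrow>
     CARD('i) = CARD('j) \<and>
     (\<forall>i. 0 \<le> b i \<and> b i \<le> c i) \<and>
     (\<forall>j. 0 \<le> d j) \<and>
     k \<le> CARD('i)"

definition mapu_polytope :: "nat \<Rightarrow> ((real ^ ('i::finite \<times> 'j::finite)) \<times> (real ^ ('i \<times> 'j))) set" where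
  "mapu_polytope k = {(x, y).
     (\<forall>j. (\<Sum>i\<in>UNIV. x $ (i, j) + y $ (i, j)) = 1) \<and>
     (\<forall>i. (\<Sum>j\<in>UNIV. x $ (i, j) + y $ (i, j)) = 1) \<and>
     (\<Sum>p\<in>UNIV. x $ p) \<le> real k \<and>
     (\<forall>p. 0 \<le> x $ p) \<and>
     (\<forall>p. 0 \<le> y $ p)}"

definition mapu_cost ::
  "('i::finite \<Rightarrow> real) \<Rightarrow> ('i \<Rightarrow> real) \<Rightarrow> ('j::finite \<Rightarrow> real) \<Rightarrow>
   (real ^ ('i \<times> 'j)) \<times> (real ^ ('i \<times> 'j)) \<Rightarrow> real" where
  "mapu_cost b c d = (\<lambda>(x, y). \<Sum>(i, j)\<in>UNIV. b i * d j * x $ (i, j) + c i * d j * y $ (i, j))"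

definition mapu_optimal ::
  "('i::finite \<Rightarrow> real) \<Rightarrow> ('i \<Rightarrow> real) \<Rightarrow> ('j::finite \<Rightarrow> real) \<Rightarrow> nat \<Rightarrow>
   (real ^ ('i \<times> 'j)) \<times> (real ^ ('i \<times> 'j)) \<Rightarrow> bool" where
  "mapu_optimal b c d k z \<longleftrightarrow>
     z \<in> mapu_polytope k \<and> (\<forall>w \<in> mapu_polytope k. mapu_cost b c d z \<le> mapu_cost b c d w)"

definition integral_point ::
  "(real ^ ('i::finite \<times> 'j::finite)) \<times> (real ^ ('i \<times> 'j)) \<Rightarrow> bool" where
  "integral_point = (\<lambda>(x, y). \<forall>p. x $ p \<in> \<int> \<and> y $ p \<in> \<int>)"

end

theory Submission
  imports Defs
begin

text \<open>
  Let \<open>p i = (\<Sum>j. x (i, j))\<close> and let \<open>F\<close> be the set of suppliers with fractional \<open>p i\<close>. Exchanging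
  the customers of two positive entries shows that in an optimal solution larger prices (a price
  being some \<open>b i\<close> or \<open>c i\<close>) meet smaller demands, so that for every initial segment \<open>U\<close> of the
  sorted prices at most one customer is served partly from inside and partly from outside \<open>U\<close>.
  A second exchange shows that \<open>b\<close> and \<open>c\<close> order \<open>F\<close> in the same way.

  Hence the mass of \<open>U\<close> is, modulo integers, a sum of \<open>p\<close> over an interval of \<open>F\<close>, that is, a
  difference of two prefix sums. Replacing each prefix sum \<open>Q\<close> of \<open>p\<close> by \<open>frac Q\<close> therefore gives
  weights \<open>\<pi>\<close> on \<open>F\<close> that sum to \<open>0\<close> over each such interval on which \<open>p\<close> has integral sum; for
  the whole of \<open>F\<close> this applies if the bound \<open>k\<close> is attained. Changing \<open>p\<close> by a small multiple
  of \<open>\<pi>\<close> and pushing the change through the partly served customers keeps the point feasible in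
  both directions. So in a vertex \<open>F\<close> is empty; then every initial segment has integral mass, no
  customer is partly served, and the point is integral.
\<close>

section \<open>Telescoping sums and fractional parts\<close>

lemma sum_telescope_ranking:
  fixes a :: "'v \<Rightarrow> real" and f :: "'v set \<Rightarrow> real"
  assumes "finite A" and "inj_on a A"
  shows "(\<Sum>v\<in>A. f {u \<in> A. a u \<le> a v} - f {u \<in> A. a u < a v}) = f A - f {}"
  using assms
proof (induction A rule: finite_ranking_induct[where f = a])
  case empty
  then show ?case by simp
next
  case (insert x S)
  show ?case
  proof (cases "x \<in> S")
    case True
    then show ?thesis using insert by (simp add: insert_absorb)
  next
    case False
    have less: "a y < a x" if "y \<in> S" for y
    proof -
      have "a y \<noteq> a x"
        using insert.prems that False by (auto simp: inj_on_def)
      then show ?thesis using insert.hyps(2)[OF that] by simp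
    qed
    have top: "{u \<in> insert x S. a u \<le> a x} = insert x S" "{u \<in> insert x S. a u < a x} = S"
      using less by (auto intro: less_imp_le)
    have rest: "{u \<in> insert x S. a u \<le> a v} = {u \<in> S. a u \<le> a v}"
      "{u \<in> insert x S. a u < a v} = {u \<in> S. a u < a v}" if "v \<in> S" for v
      using less[OF that] by auto
    have IH: "(\<Sum>v\<in>S. f {u \<in> S. a u \<le> a v} - f {u \<in> S. a u < a v}) = f S - f {}"
      using insert by simp
    have "(\<Sum>v\<in>S. f {u \<in> insert x S. a u \<le> a v} - f {u \<in> insert x S. a u < a v}) = f S - f {}"
      unfolding IH[symmetric] by (rule sum.cong) (simp_all only: rest)
    then show ?thesis
      unfolding sum.insert[OF insert.hyps(1) False] top by simp
  qed
qed

lemma frac_eq_if_diff_Ints: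
  fixes x y :: real
  assumes "x - y \<in> \<int>"
  shows "frac x = frac y"
proof -
  obtain n where "x - y = of_int n" using assms by (auto elim: Ints_cases)
  then have "x = y + of_int n" by simp
  then show ?thesis by (simp add: frac_def)
qed

lemma diff_Ints_if_frac_eq:
  fixes x y :: real
  assumes "frac x = frac y"
  shows "x - y \<in> \<int>"
proof -
  have "x - y = of_int (\<lfloor>x\<rfloor> - \<lfloor>y\<rfloor>)" using assms by (simp add: frac_def)
  then show ?thesis by (metis Ints_of_int)
qed

lemma sum_UNIV_bool_times:
  fixes f :: "bool \<times> 'i::finite \<Rightarrow> real"
  shows "(\<Sum>v\<in>UNIV. f v) = (\<Sum>i\<in>UNIV. f (True, i)) + (\<Sum>i\<in>UNIV. f (False, i))"
proof -
  have "(\<Sum>v\<in>UNIV. f v) = (\<Sum>t\<in>UNIV. \<Sum>i\<in>UNIV. f (t, i))"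
    unfolding UNIV_Times_UNIV[symmetric] sum.cartesian_product by simp
  then show ?thesis by (simp add: UNIV_bool)
qed

text \<open>A point \<open>(x, y)\<close> is read as one matrix \<open>z\<close> whose rows are the pairs \<open>(True, i)\<close>,
  of price \<open>b i\<close> and carrying \<open>x\<close>, and \<open>(False, i)\<close>, of price \<open>c i\<close> and carrying \<open>y\<close>.\<close>

locale optimal_vertex =
  fixes z :: "bool \<times> 'i::finite \<Rightarrow> 'j::finite \<Rightarrow> real"
    and a :: "bool \<times> 'i \<Rightarrow> real"
    and d :: "'j \<Rightarrow> real"
    and k :: nat
  assumes inj_a: "inj a"
    and inj_d: "inj d"
    and d_nonneg: "0 \<le> d j"
    and a_less: "a (True, i) < a (False, i)"
    and z_nonneg: "0 \<le> z v j"
    and col: "(\<Sum>v\<in>UNIV. z v j) = 1"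
    and row: "(\<Sum>j\<in>UNIV. z (True, i) j) + (\<Sum>j\<in>UNIV. z (False, i) j) = 1"
    and opt: "\<lbrakk>\<And>j. (\<Sum>v\<in>UNIV. h v j) = 0;
        \<And>i. (\<Sum>j\<in>UNIV. h (True, i) j) + (\<Sum>j\<in>UNIV. h (False, i) j) = 0;
        \<And>v j. z v j = 0 \<Longrightarrow> 0 \<le> h v j;
        (\<Sum>i\<in>UNIV. \<Sum>j\<in>UNIV. h (True, i) j) = 0\<rbrakk>
        \<Longrightarrow> 0 \<le> (\<Sum>v\<in>UNIV. \<Sum>j\<in>UNIV. a v * d j * h v j)"
    and ext: "\<lbrakk>\<And>j. (\<Sum>v\<in>UNIV. h v j) = 0;
        \<And>i. (\<Sum>j\<in>UNIV. h (True, i) j) + (\<Sum>j\<in>UNIV. h (False, i) j) = 0;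
        \<And>v j. z v j = 0 \<Longrightarrow> h v j = 0;
        (\<Sum>i\<in>UNIV. \<Sum>j\<in>UNIV. z (True, i) j) = real k \<Longrightarrow> (\<Sum>i\<in>UNIV. \<Sum>j\<in>UNIV. h (True, i) j) = 0\<rbrakk>
        \<Longrightarrow> h v j = 0"
begin

section \<open>Exchanges between two positive entries\<close>

definition unit :: "bool \<times> 'i \<Rightarrow> 'j \<Rightarrow> bool \<times> 'i \<Rightarrow> 'j \<Rightarrow> real" where
  "unit v j u l = (if u = v then if l = j then 1 else 0 else 0)"

lemma sum_unit_row: "(\<Sum>l\<in>UNIV. unit v j u l) = (if u = v then 1 else 0)"
  by (simp add: unit_def)

lemma sum_unit_col: "(\<Sum>u\<in>UNIV. unit v j u l) = (if l = j then 1 else 0)"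
  by (simp add: unit_def)

lemma sum_unit_cost: "(\<Sum>u\<in>UNIV. \<Sum>l\<in>UNIV. a u * d l * unit v j u l) = a v * d j"
proof -
  have "(\<Sum>l\<in>UNIV. a u * d l * unit v j u l) = (if u = v then a v * d j else 0)" for u
    by (simp add: unit_def if_distrib[of "\<lambda>x. _ * x"] cong: if_cong)
  then show ?thesis by simp
qed

text \<open>The two units trade customers and possibly types. Supplier totals and the number of
  upgrades stay fixed, so \<open>opt\<close> forbids a drop in cost.\<close>

lemma swap_le:
  assumes pos: "0 < z v j" "0 < z v' j'"
    and supplier: "snd w = snd v" "snd w' = snd v'"
    and types: "fst w = fst v \<and> fst w' = fst v' \<or> fst w = fst v' \<and> fst w' = fst v"
  shows "a v * d j + a v' * d j' \<le> a w * d j' + a w' * d j"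
proof -
  define h where "h u l = unit w j' u l + unit w' j u l - unit v j u l - unit v' j' u l" for u l
  have sum_True: "(\<Sum>i\<in>UNIV. if (True, i) = u then 1 else 0) = (if fst u then 1 else (0::real))"
    for u :: "bool \<times> 'i"
    by (cases u) simp
  have "0 \<le> (\<Sum>v\<in>UNIV. \<Sum>j\<in>UNIV. a v * d j * h v j)"
  proof (rule opt)
    show "(\<Sum>v\<in>UNIV. h v j) = 0" for j
      by (simp add: h_def sum.distrib sum_subtractf sum_unit_col)
    show "(\<Sum>j\<in>UNIV. h (True, i) j) + (\<Sum>j\<in>UNIV. h (False, i) j) = 0" for i
    proof -
      have unit_row: "(\<Sum>l\<in>UNIV. unit u j (True, i) l) + (\<Sum>l\<in>UNIV. unit u j (False, i) l)
          = (if snd u = i then 1 else 0)" for u j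
        by (cases u) (auto simp: sum_unit_row)
      show ?thesis
        using unit_row[of w j'] unit_row[of w' j] unit_row[of v j] unit_row[of v' j']
        unfolding h_def sum.distrib sum_subtractf supplier by linarith
    qed
    show "0 \<le> h v j" if "z v j = 0" for v j
      using that pos by (auto simp: h_def unit_def)
    have "(\<Sum>i\<in>UNIV. \<Sum>j\<in>UNIV. h (True, i) j)
       = (if fst w then 1 else 0) + (if fst w' then 1 else 0)
         - (if fst v then 1 else 0) - (if fst v' then 1 else 0)"
      by (simp only: h_def sum.distrib sum_subtractf sum_unit_row sum_True)
    also have "\<dots> = 0" using types by auto
    finally show "(\<Sum>i\<in>UNIV. \<Sum>j\<in>UNIV. h (True, i) j) = 0" .
  qed
  also have "(\<Sum>v\<in>UNIV. \<Sum>j\<in>UNIV. a v * d j * h v j)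
      = a w * d j' + a w' * d j - a v * d j - a v' * d j'"
    by (simp only: h_def distrib_left right_diff_distrib sum.distrib sum_subtractf sum_unit_cost)
  finally show ?thesis by simp
qed

text \<open>The exchange with \<open>w = v\<close> and \<open>w' = v'\<close> changes the cost by
  \<open>(a v' - a v) * (d j - d j')\<close>.\<close>

lemma support_antitone:
  assumes "0 < z v j" "0 < z v' j'" "a v < a v'"
  shows "d j' \<le> d j"
proof -
  have "a v * d j + a v' * d j' \<le> a v * d j' + a v' * d j"
    using swap_le[OF assms(1,2), of v v'] by simp
  then have "0 \<le> (a v' - a v) * (d j - d j')" by (simp add: algebra_simps)
  then show ?thesis using assms(3) by (simp add: zero_le_mult_iff)
qed

section \<open>Upgrade masses and the order of fractional suppliers\<close>

definition p :: "'i \<Rightarrow> real" where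
  "p i = (\<Sum>j\<in>UNIV. z (True, i) j)"

definition F :: "'i set" where
  "F = {i. 0 < p i \<and> p i < 1}"

lemma sum_False: "(\<Sum>j\<in>UNIV. z (False, i) j) = 1 - p i"
  using row[of i] by (simp add: p_def)

lemma p_bounds: "0 \<le> p i" "p i \<le> 1"
proof -
  show "0 \<le> p i" by (simp add: p_def sum_nonneg z_nonneg)
  have "0 \<le> (\<Sum>j\<in>UNIV. z (False, i) j)" by (simp add: sum_nonneg z_nonneg)
  then show "p i \<le> 1" by (simp add: sum_False)
qed

lemma p_Ints: "i \<notin> F \<Longrightarrow> p i \<in> \<int>"
  using p_bounds[of i] by (auto simp: F_def not_less)

lemma p_not_Ints: "i \<in> F \<Longrightarrow> p i \<notin> \<int>"
  by (auto simp: F_def elim!: Ints_cases)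

lemma mass_pos:
  assumes "i \<in> F"
  shows "0 < (\<Sum>j\<in>UNIV. z (t, i) j)"
  using assms sum_False[of i] by (cases t) (auto simp: F_def p_def)

lemma F_support:
  assumes "i \<in> F"
  obtains j where "0 < z (t, i) j"
proof -
  have "\<exists>j. z (t, i) j \<noteq> 0"
    using mass_pos[OF assms, of t] by (rule contrapos_pp) simp
  then show ?thesis using that z_nonneg[of "(t, i)"] by (auto simp: less_le)
qed

text \<open>Shifting upgrade from \<open>i'\<close> to \<open>i\<close> while the used types stay with the customers
  lowers the cost if the price interval of \<open>i\<close> strictly contains that of \<open>i'\<close>.\<close>

lemma order_compatible_less:
  assumes "i \<in> F" "i' \<in> F" and b: "a (True, i) < a (True, i')"
  shows "a (False, i) < a (False, i')"
proof (rule ccontr)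
  assume "\<not> ?thesis"
  moreover have "a (False, i) \<noteq> a (False, i')" using b inj_a by (auto dest: injD)
  ultimately have c: "a (False, i') < a (False, i)" by simp
  \<comment> \<open>The exchange saves a combination of \<open>d j\<close> and \<open>d j'\<close>
    with positive coefficients, so only zero demands escape a contradiction here.\<close>
  have zero: "d j = 0 \<and> d j' = 0" if pos: "0 < z (False, i) j" "0 < z (True, i') j'" for j j'
  proof -
    have "a (False, i) * d j + a (True, i') * d j' \<le> a (True, i) * d j' + a (False, i') * d j"
      using swap_le[OF pos, of "(True, i)" "(False, i')"] by simp
    then have *: "(a (False, i) - a (False, i')) * d j + (a (True, i') - a (True, i)) * d j' \<le> 0"
      by (simp add: algebra_simps)
    have "0 \<le> (a (False, i) - a (False, i')) * d j" "0 \<le> (a (True, i') - a (True, i)) * d j'"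
      using b c d_nonneg by simp_all
    with * have "(a (False, i) - a (False, i')) * d j = 0" "(a (True, i') - a (True, i)) * d j' = 0"
      by linarith+
    then show ?thesis using b c by simp
  qed
  obtain j0 where j0: "0 < z (False, i) j0" using F_support[OF assms(1)] .
  obtain j1 where j1: "0 < z (True, i') j1" using F_support[OF assms(2)] .
  have d0: "d j0 = 0" using zero[OF j0 j1] by simp
  \<comment> \<open>Demands are distinct, so \<open>j0\<close> is the only customer of demand zero
    and takes all that \<open>i'\<close> supplies.\<close>
  have only: "z (t, i') j = 0" if "j \<noteq> j0" for t j
  proof (rule ccontr)
    assume "z (t, i') j \<noteq> 0"
    then have pos: "0 < z (t, i') j" using z_nonneg[of "(t, i')" j] by simp
    have "d j = 0"
    proof (cases t)
      case True
      then show ?thesis using zero[OF j0] pos by simp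
    next
      case False
      then have "d j \<le> d j1" using support_antitone[OF j1 _ a_less, of j] pos by simp
      then show ?thesis using zero[OF j0 j1] d_nonneg[of j] by simp
    qed
    then show False using that d0 inj_d by (metis injD)
  qed
  have single: "(\<Sum>j\<in>UNIV. z (t, i') j) = z (t, i') j0" for t
    using sum.mono_neutral_right[of UNIV "{j0}" "z (t, i')"] only by auto
  have ne: "i \<noteq> i'" using b by auto
  \<comment> \<open>Column \<open>j0\<close> would hold the full unit of \<open>i'\<close> and a
    positive part from \<open>i\<close>.\<close>
  have "1 + z (False, i) j0 = (\<Sum>v\<in>{(True, i'), (False, i'), (False, i)}. z v j0)"
    using row[of i'] ne by (simp add: single)
  also have "\<dots> \<le> (\<Sum>v\<in>UNIV. z v j0)"
    by (rule sum_mono2) (auto simp: z_nonneg)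
  finally show False using j0 by (simp add: col)
qed

lemma order_compatible:
  assumes "i \<in> F" "i' \<in> F"
  shows "a (False, i) < a (False, i') \<longleftrightarrow> a (True, i) < a (True, i')"
proof
  assume c: "a (False, i) < a (False, i')"
  then have "i \<noteq> i'" by auto
  then have "a (True, i) \<noteq> a (True, i')" using inj_a by (auto dest: injD)
  moreover have "\<not> a (True, i') < a (True, i)"
    using order_compatible_less[OF assms(2,1)] c by auto
  ultimately show "a (True, i) < a (True, i')" by simp
next
  show "a (True, i) < a (True, i') \<Longrightarrow> a (False, i) < a (False, i')"
    using assms by (rule order_compatible_less)
qed

section \<open>Initial segments of prices and straddling customers\<close>

definition initial :: "(bool \<times> 'i) set \<Rightarrow> bool" where
  "initial U \<longleftrightarrow> (\<forall>u\<in>U. \<forall>w. a w \<le> a u \<longrightarrow> w \<in> U)"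

lemma initial_le: "initial {u. a u \<le> s}" and initial_less: "initial {u. a u < s}"
  by (auto simp: initial_def)

definition X :: "(bool \<times> 'i) set \<Rightarrow> 'j \<Rightarrow> real" where
  "X U j = (\<Sum>u\<in>U. z u j)"

definition straddles :: "(bool \<times> 'i) set \<Rightarrow> 'j \<Rightarrow> bool" where
  "straddles U j \<longleftrightarrow> 0 < X U j \<and> X U j < 1"

lemma X_bounds: "0 \<le> X U j" "X U j \<le> 1"
proof -
  show "0 \<le> X U j" by (simp add: X_def sum_nonneg z_nonneg)
  have "X U j \<le> (\<Sum>v\<in>UNIV. z v j)"
    unfolding X_def by (rule sum_mono2) (auto simp: z_nonneg)
  then show "X U j \<le> 1" by (simp add: col)
qed

lemma straddles_supportE:
  assumes "straddles U j"
  obtains u w where "u \<in> U" "0 < z u j" "w \<notin> U" "0 < z w j"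
proof -
  have "\<exists>u\<in>U. z u j \<noteq> 0"
    using assms unfolding straddles_def X_def by (metis less_irrefl sum.neutral)
  moreover have "\<exists>w\<in>-U. z w j \<noteq> 0"
  proof (rule ccontr)
    assume "\<not> ?thesis"
    then have "X U j = (\<Sum>v\<in>UNIV. z v j)"
      unfolding X_def by (intro sum.mono_neutral_left) auto
    then show False using assms by (simp add: straddles_def col)
  qed
  ultimately show ?thesis using that z_nonneg by (metis ComplD less_le)
qed

lemma initial_separates: "initial U \<Longrightarrow> u \<in> U \<Longrightarrow> w \<notin> U \<Longrightarrow> a u < a w"
  by (meson initial_def not_le)

text \<open>Each of the two customers is served from inside and from outside \<open>U\<close>, so
  \<open>support_antitone\<close> compares their demands both ways.\<close>

lemma straddles_unique:
  assumes "initial U" "straddles U j" "straddles U j'"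
  shows "j = j'"
proof -
  obtain u w where 1: "u \<in> U" "0 < z u j" "w \<notin> U" "0 < z w j"
    using straddles_supportE[OF assms(2)] .
  obtain u' w' where 2: "u' \<in> U" "0 < z u' j'" "w' \<notin> U" "0 < z w' j'"
    using straddles_supportE[OF assms(3)] .
  have "d j' \<le> d j" "d j \<le> d j'"
    using 1 2 support_antitone initial_separates[OF assms(1)] by meson+
  then show ?thesis using inj_d by (auto dest: injD)
qed

lemma X_not_straddles: "\<not> straddles U j \<Longrightarrow> X U j \<in> \<int>"
  using X_bounds[of U j] by (auto simp: straddles_def not_less)

text \<open>At most one column of \<open>X U\<close> is fractional, and a single one would make the
  total fractional.\<close>

lemma no_straddle_if_Ints:
  assumes "initial U" "(\<Sum>j\<in>UNIV. X U j) \<in> \<int>"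
  shows "\<not> straddles U j"
proof
  assume j: "straddles U j"
  have "(\<Sum>l\<in>UNIV - {j}. X U l) \<in> \<int>"
    using straddles_unique[OF assms(1) j] by (intro Ints_sum X_not_straddles) auto
  moreover have "(\<Sum>l\<in>UNIV. X U l) = X U j + (\<Sum>l\<in>UNIV - {j}. X U l)"
    by (simp add: sum.remove)
  ultimately have "X U j \<in> \<int>" using assms(2) by (metis Ints_diff add_diff_cancel_right')
  then show False using j by (auto simp: straddles_def elim!: Ints_cases)
qed

lemma sum_X:
  "(\<Sum>j\<in>UNIV. X U j) = (\<Sum>i | (True, i) \<in> U. p i) + (\<Sum>i | (False, i) \<in> U. 1 - p i)"
proof -
  have "(\<Sum>j\<in>UNIV. X U j) = (\<Sum>u\<in>U. \<Sum>j\<in>UNIV. z u j)"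
    unfolding X_def by (rule sum.swap)
  also have "\<dots> = (\<Sum>u\<in>UNIV. if u \<in> U then \<Sum>j\<in>UNIV. z u j else 0)"
    by (simp add: sum.If_cases)
  also have "\<dots> = (\<Sum>i\<in>UNIV. if (True, i) \<in> U then p i else 0)
      + (\<Sum>i\<in>UNIV. if (False, i) \<in> U then 1 - p i else 0)"
    by (simp only: sum_UNIV_bool_times sum_False p_def[symmetric])
  also have "\<dots> = (\<Sum>i | (True, i) \<in> U. p i) + (\<Sum>i | (False, i) \<in> U. 1 - p i)"
    by (simp add: sum.If_cases)
  finally show ?thesis .
qed

section \<open>The perturbation from fractional prefix sums\<close>

lemma sum_p_F: "(\<Sum>i\<in>A. p i) - (\<Sum>i\<in>A \<inter> F. p i) \<in> \<int>"
proof -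
  have "(\<Sum>i\<in>A. p i) = (\<Sum>i\<in>A \<inter> F. p i) + (\<Sum>i\<in>A - F. p i)"
    by (simp add: sum.Int_Diff)
  then show ?thesis by (auto intro!: Ints_sum p_Ints)
qed

text \<open>The intended change of the mass of \<open>U\<close>, which by \<open>sum_X\<close> and
  \<open>sum_p_F\<close> is the difference of these two sums modulo integers. Separate fractional
  parts let the change between consecutive segments reduce to the weights
  \<open>\<pi>\<close>.\<close>

definition shift :: "(bool \<times> 'i) set \<Rightarrow> real" where
  "shift U = frac (\<Sum>i | i \<in> F \<and> (True, i) \<in> U. p i) - frac (\<Sum>i | i \<in> F \<and> (False, i) \<in> U. p i)"

text \<open>The two sums then differ by an integer. Hence a segment that no customer straddles has
  no change to absorb.\<close>

lemma shift_eq_0_if_Ints: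
  assumes "(\<Sum>j\<in>UNIV. X U j) \<in> \<int>"
  shows "shift U = 0"
proof -
  let ?B = "{i. (True, i) \<in> U}" and ?C = "{i. (False, i) \<in> U}"
  have "sum p ?B - sum p ?C = (\<Sum>j\<in>UNIV. X U j) - real (card ?C)"
    by (simp add: sum_X sum_subtractf)
  then have "sum p ?B - sum p ?C \<in> \<int>" using assms by (metis Ints_diff Ints_of_nat)
  moreover have "sum p (?B \<inter> F) - sum p (?C \<inter> F)
      = (sum p ?B - sum p ?C) - (sum p ?B - sum p (?B \<inter> F)) + (sum p ?C - sum p (?C \<inter> F))"
    by simp
  ultimately have "sum p (?B \<inter> F) - sum p (?C \<inter> F) \<in> \<int>"
    using sum_p_F[of ?B] sum_p_F[of ?C] by (metis Ints_add Ints_diff)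
  then have "frac (sum p (?B \<inter> F)) = frac (sum p (?C \<inter> F))" by (rule frac_eq_if_diff_Ints)
  moreover have "?B \<inter> F = {i. i \<in> F \<and> (True, i) \<in> U}" "?C \<inter> F = {i. i \<in> F \<and> (False, i) \<in> U}"
    by auto
  ultimately show ?thesis by (simp add: shift_def)
qed

text \<open>The change of \<open>X U\<close>: the straddling customer absorbs all of it, since only
  its entry lies strictly between 0 and 1.\<close>

definition H :: "(bool \<times> 'i) set \<Rightarrow> 'j \<Rightarrow> real" where
  "H U j = (if straddles U j then shift U else 0)"

lemma sum_H:
  assumes "initial U"
  shows "(\<Sum>j\<in>UNIV. H U j) = shift U"
proof (cases "\<exists>j. straddles U j")
  case True
  then obtain j where j: "straddles U j" by blast
  have "H U l = (if l = j then shift U else 0)" for l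
    using j straddles_unique[OF assms j, of l] by (cases "l = j") (auto simp: H_def)
  then show ?thesis by simp
next
  case False
  then have "shift U = 0" by (intro shift_eq_0_if_Ints Ints_sum X_not_straddles) auto
  then show ?thesis using False by (simp add: H_def)
qed

text \<open>Prices are distinct, so the two segments differ only in \<open>v\<close>, and
  \<open>h\<close> arises from \<open>H\<close> as \<open>z\<close> does from
  \<open>X\<close>.\<close>

definition h :: "bool \<times> 'i \<Rightarrow> 'j \<Rightarrow> real" where
  "h v j = H {u. a u \<le> a v} j - H {u. a u < a v} j"

definition \<pi> :: "'i \<Rightarrow> real" where
  "\<pi> i = frac (\<Sum>i' | i' \<in> F \<and> a (True, i') \<le> a (True, i). p i')
       - frac (\<Sum>i' | i' \<in> F \<and> a (True, i') < a (True, i). p i')"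

lemma le_eq_insert: "{u. a u \<le> a v} = insert v {u. a u < a v}"
  using inj_a by (auto simp: less_le dest: injD)

text \<open>Adding \<open>(t, i)\<close> to the segment can change only the sum of its own type. By
  \<open>order_compatible\<close> both prices give the same prefixes of \<open>F\<close>, so the two
  types receive the same weight with opposite signs.\<close>

lemma shift_diff:
  "shift {u. a u \<le> a (t, i)} - shift {u. a u < a (t, i)} = (if i \<in> F then if t then \<pi> i else - \<pi> i else 0)"
proof -
  have other: "a (t', i') \<le> a (t, i) \<longleftrightarrow> a (t', i') < a (t, i)" if "(t', i') \<noteq> (t, i)" for t' i'
    using inj_a that by (auto dest: injD simp: less_le)
  have le: "{i' \<in> F. a (t', i') \<le> a (t, i)} = {i' \<in> F. a (t', i') < a (t, i)}" if "i \<notin> F \<or> t' \<noteq> t" for t'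
  proof -
    have "(t', i') \<noteq> (t, i)" if "i' \<in> F" for i'
      using \<open>i \<notin> F \<or> t' \<noteq> t\<close> that by auto
    then show ?thesis using other by blast
  qed
  consider "i \<notin> F" | "i \<in> F" "t" | "i \<in> F" "\<not> t" by blast
  then show ?thesis
  proof cases
    case 1
    then show ?thesis using le by (simp add: shift_def)
  next
    case 2
    then show ?thesis using le[of False] by (simp add: shift_def \<pi>_def)
  next
    case 3
    have "{i' \<in> F. a (False, i') < a (False, i)} = {i' \<in> F. a (True, i') < a (True, i)}"
      using order_compatible 3 by blast
    moreover have "{i' \<in> F. a (False, i') \<le> a (False, i)} = {i' \<in> F. a (True, i') \<le> a (True, i)}"
      using order_compatible 3 by (metis not_less)
    ultimately show ?thesis using 3 le[of True] by (simp add: shift_def \<pi>_def)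
  qed
qed

lemma h_row: "(\<Sum>j\<in>UNIV. h (t, i) j) = (if i \<in> F then if t then \<pi> i else - \<pi> i else 0)"
  by (simp only: h_def sum_subtractf sum_H initial_le initial_less shift_diff)

text \<open>The sum telescopes along the sorted prices to the full and the empty segment, which
  nobody straddles.\<close>

lemma h_col: "(\<Sum>v\<in>UNIV. h v j) = 0"
proof -
  have "(\<Sum>v\<in>UNIV. h v j) = H UNIV j - H {} j"
    using sum_telescope_ranking[of UNIV a "\<lambda>U. H U j"] inj_a by (simp add: h_def)
  also have "\<dots> = 0" by (simp add: H_def straddles_def X_def col)
  finally show ?thesis .
qed

text \<open>Row \<open>v\<close> adds nothing to column \<open>j\<close>, so \<open>j\<close>
  straddles both segments or neither; it remains to see that \<open>shift\<close> agrees on them if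
  it straddles both.\<close>

lemma h_support:
  assumes "z v j = 0"
  shows "h v j = 0"
proof -
  let ?L = "{u. a u < a v}" and ?U = "{u. a u \<le> a v}"
  have "X ?U j = X ?L j" using assms by (simp add: le_eq_insert X_def)
  then have same: "straddles ?U j \<longleftrightarrow> straddles ?L j" by (simp add: straddles_def)
  have "shift ?U = shift ?L" if L: "straddles ?L j"
  proof -
    obtain u where u: "u \<in> ?L" "0 < z u j" using straddles_supportE[OF L] by blast
    have "straddles ?U j" using that same by simp
    then obtain w where w: "w \<notin> ?U" "0 < z w j" using straddles_supportE[of ?U j] by blast
    obtain t i where v: "v = (t, i)" by (cases v)
    \<comment> \<open>A positive entry \<open>z v l\<close> would be squeezed between the cheaper
      \<open>u\<close> and the dearer \<open>w\<close>, both serving \<open>j\<close>, which forces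
      \<open>l = j\<close>.\<close>
    have "i \<notin> F"
    proof
      assume "i \<in> F"
      then obtain l where l: "0 < z v l" unfolding v by (rule F_support)
      have "d l \<le> d j" "d j \<le> d l"
        using support_antitone[OF u(2) l] support_antitone[OF l w(2)] u w by auto
      then have "l = j" using inj_d by (auto dest: injD)
      then show False using l assms by simp
    qed
    then show ?thesis using shift_diff[of t i] v by simp
  qed
  then show ?thesis using same by (simp add: h_def H_def)
qed

text \<open>Consecutive prefix sums differ by \<open>p i\<close>, which is not an integer, so their
  fractional parts differ.\<close>

lemma \<pi>_nonzero:
  assumes "i \<in> F"
  shows "\<pi> i \<noteq> 0"
proof
  assume "\<pi> i = 0"
  let ?L = "{i' \<in> F. a (True, i') < a (True, i)}"
  have "{i' \<in> F. a (True, i') \<le> a (True, i)} = insert i ?L"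
    using assms inj_a by (auto dest: injD simp: le_less)
  then have "frac (p i + sum p ?L) = frac (sum p ?L)"
    using \<open>\<pi> i = 0\<close> by (simp add: \<pi>_def)
  then have "p i \<in> \<int>" using diff_Ints_if_frac_eq[of "p i + sum p ?L" "sum p ?L"] by simp
  then show False using p_not_Ints[OF assms] by simp
qed

text \<open>Telescoping leaves the fractional part of the sum of \<open>p\<close> over
  \<open>F\<close>. This keeps a tight upgrade bound tight.\<close>

lemma sum_\<pi>:
  assumes "(\<Sum>i\<in>UNIV. p i) \<in> \<int>"
  shows "(\<Sum>i\<in>F. \<pi> i) = 0"
proof -
  have "inj_on (\<lambda>i. a (True, i)) F"
    using inj_a by (auto simp: inj_on_def)
  then have "(\<Sum>i\<in>F. \<pi> i) = frac (sum p F) - frac (sum p {})"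
    using sum_telescope_ranking[of F "\<lambda>i. a (True, i)" "\<lambda>A. frac (sum p A)"]
    by (simp add: \<pi>_def)
  moreover have "sum p F \<in> \<int>"
    using Ints_diff[OF assms sum_p_F[of UNIV]] by simp
  ultimately show ?thesis by simp
qed

text \<open>By \<open>ext\<close> the direction \<open>h\<close> vanishes, yet its row
  \<open>(True, i)\<close> sums to \<open>\<pi> i\<close>, which is nonzero for \<open>i\<close> in
  \<open>F\<close>.\<close>

lemma F_empty: "F = {}"
proof (rule ccontr)
  assume "F \<noteq> {}"
  then obtain i where i: "i \<in> F" by blast
  have "h v j = 0" for v j
  proof (rule ext)
    show "(\<Sum>v\<in>UNIV. h v j) = 0" for j by (rule h_col)
    show "(\<Sum>j\<in>UNIV. h (True, i) j) + (\<Sum>j\<in>UNIV. h (False, i) j) = 0" for i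
      by (simp add: h_row)
    show "h v j = 0" if "z v j = 0" for v j using that by (rule h_support)
    assume "(\<Sum>i\<in>UNIV. \<Sum>j\<in>UNIV. z (True, i) j) = real k"
    then have "(\<Sum>i\<in>UNIV. p i) \<in> \<int>" by (simp add: p_def)
    then show "(\<Sum>i\<in>UNIV. \<Sum>j\<in>UNIV. h (True, i) j) = 0"
      using sum_\<pi> by (simp add: h_row sum.If_cases)
  qed
  then have "\<pi> i = 0" using h_row[of True i] i by simp
  then show False using \<pi>_nonzero[OF i] by simp
qed

text \<open>With \<open>F\<close> empty every initial segment has integral mass, so no customer
  straddles one, and each entry is a difference of two integral values of \<open>X\<close>.\<close>

lemma integral: "z v j \<in> \<int>"
proof -
  have X_Ints: "X U j \<in> \<int>" if "initial U" for U
  proof (rule X_not_straddles, rule no_straddle_if_Ints[OF that])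
    show "(\<Sum>j\<in>UNIV. X U j) \<in> \<int>"
      unfolding sum_X using p_Ints F_empty by (intro Ints_add Ints_sum Ints_diff) auto
  qed
  have "z v j = X {u. a u \<le> a v} j - X {u. a u < a v} j"
    by (simp add: le_eq_insert X_def)
  then show ?thesis using X_Ints initial_le initial_less by (metis Ints_diff)
qed

end

section \<open>Translation between the polytope and the matrix form\<close>

definition joint :: "(real ^ ('i::finite \<times> 'j::finite)) \<times> (real ^ ('i \<times> 'j)) \<Rightarrow> bool \<times> 'i \<Rightarrow> 'j \<Rightarrow> real" where
  "joint w v j = (if fst v then fst w else snd w) $ (snd v, j)"

definition direction :: "(bool \<times> 'i::finite \<Rightarrow> 'j::finite \<Rightarrow> real) \<Rightarrow> (real ^ ('i \<times> 'j)) \<times> (real ^ ('i \<times> 'j))" where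
  "direction h = ((\<chi> q. h (True, fst q) (snd q)), (\<chi> q. h (False, fst q) (snd q)))"

lemma joint_direction: "joint (w + e *\<^sub>R direction h) v j = joint w v j + e * h v j"
  by (cases v) (simp add: joint_def direction_def)

lemma sum_UNIV_pair:
  fixes f :: "'i::finite \<times> 'j::finite \<Rightarrow> real"
  shows "(\<Sum>q\<in>UNIV. f q) = (\<Sum>i\<in>UNIV. \<Sum>j\<in>UNIV. f (i, j))"
  unfolding UNIV_Times_UNIV[symmetric] sum.cartesian_product by simp

lemma mem_polytope_iff:
  "w \<in> mapu_polytope k \<longleftrightarrow>
    (\<forall>j. (\<Sum>v\<in>UNIV. joint w v j) = 1) \<and>
    (\<forall>i. (\<Sum>j\<in>UNIV. joint w (True, i) j) + (\<Sum>j\<in>UNIV. joint w (False, i) j) = 1) \<and>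
    (\<Sum>i\<in>UNIV. \<Sum>j\<in>UNIV. joint w (True, i) j) \<le> real k \<and>
    (\<forall>v j. 0 \<le> joint w v j)"
proof (cases w)
  case (Pair x y)
  have "(\<forall>v j. 0 \<le> joint w v j) \<longleftrightarrow> (\<forall>q. 0 \<le> x $ q) \<and> (\<forall>q. 0 \<le> y $ q)"
    by (auto simp: joint_def Pair)
  then show ?thesis
    by (simp add: Pair mapu_polytope_def sum_UNIV_bool_times joint_def sum.distrib sum_UNIV_pair)
qed

lemma cost_joint:
  "mapu_cost b c d w = (\<Sum>v\<in>UNIV. \<Sum>j\<in>UNIV. (if fst v then b (snd v) else c (snd v)) * d j * joint w v j)"
  by (cases w) (simp add: mapu_cost_def sum_UNIV_bool_times sum_UNIV_pair joint_def sum.distrib)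

text \<open>A positive value survives small steps by continuity; a zero value relies on the
  slope.\<close>

lemma eventually_pos_line:
  fixes x y :: real
  assumes "0 \<le> x" "x = 0 \<Longrightarrow> 0 \<le> y"
  shows "\<forall>\<^sub>F e in at_right 0. 0 \<le> x + e * y"
proof (cases "x = 0")
  case True
  then show ?thesis
    using assms eventually_at_right_less[of "0::real"] by (auto elim: eventually_mono)
next
  case False
  have "((\<lambda>e. x + e * y) \<longlongrightarrow> x + 0 * y) (at_right 0)" by (intro tendsto_intros)
  then have "\<forall>\<^sub>F e in at_right 0. 0 < x + e * y"
    using False assms(1) by (intro order_tendstoD(1)[where y = "x + 0 * y"]) auto
  then show ?thesis by (auto elim: eventually_mono)
qed

text \<open>The equations hold along the whole line, and each of the finitely many inequalities
  holds for small steps.\<close>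

lemma eventually_feasible:
  assumes w: "w \<in> mapu_polytope k"
    and col: "\<And>j. (\<Sum>v\<in>UNIV. h v j) = 0"
    and row: "\<And>i. (\<Sum>j\<in>UNIV. h (True, i) j) + (\<Sum>j\<in>UNIV. h (False, i) j) = 0"
    and sign: "\<And>v j. joint w v j = 0 \<Longrightarrow> 0 \<le> h v j"
    and total: "(\<Sum>i\<in>UNIV. \<Sum>j\<in>UNIV. joint w (True, i) j) = real k
        \<Longrightarrow> (\<Sum>i\<in>UNIV. \<Sum>j\<in>UNIV. h (True, i) j) = 0"
  shows "\<forall>\<^sub>F e in at_right 0. w + e *\<^sub>R direction h \<in> mapu_polytope k"
proof -
  note mem = w[unfolded mem_polytope_iff]
  let ?x = "\<Sum>i\<in>UNIV. \<Sum>j\<in>UNIV. joint w (True, i) j" and ?h = "\<Sum>i\<in>UNIV. \<Sum>j\<in>UNIV. h (True, i) j"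
  have "\<forall>\<^sub>F e in at_right 0. \<forall>v j. 0 \<le> joint w v j + e * h v j"
    using mem sign by (intro eventually_all_finite eventually_pos_line) auto
  \<comment> \<open>The upgrade bound is handled as one more nonnegative quantity, its slack, with
    slope \<open>- ?h\<close>.\<close>
  moreover have "\<forall>\<^sub>F e in at_right 0. 0 \<le> (real k - ?x) + e * (- ?h)"
    using mem total by (intro eventually_pos_line) auto
  ultimately show ?thesis
  proof eventually_elim
    case (elim e)
    have "(\<Sum>j\<in>UNIV. joint w (True, i) j + e * h (True, i) j)
        + (\<Sum>j\<in>UNIV. joint w (False, i) j + e * h (False, i) j)
      = (\<Sum>j\<in>UNIV. joint w (True, i) j) + (\<Sum>j\<in>UNIV. joint w (False, i) j)
        + e * ((\<Sum>j\<in>UNIV. h (True, i) j) + (\<Sum>j\<in>UNIV. h (False, i) j))" for i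
      by (simp add: sum.distrib sum_distrib_left[symmetric] distrib_left)
    then have "(\<Sum>j\<in>UNIV. joint w (True, i) j + e * h (True, i) j)
        + (\<Sum>j\<in>UNIV. joint w (False, i) j + e * h (False, i) j) = 1" for i
      using mem row by simp
    moreover have "(\<Sum>v\<in>UNIV. joint w v j + e * h v j) = 1" for j
      using mem col by (simp add: sum.distrib sum_distrib_left[symmetric])
    moreover have "(\<Sum>i\<in>UNIV. \<Sum>j\<in>UNIV. joint w (True, i) j + e * h (True, i) j) \<le> real k"
      using elim(2) by (simp add: sum.distrib sum_distrib_left[symmetric])
    ultimately show ?case
      unfolding mem_polytope_iff joint_direction using elim(1) by blast
  qed
qed

lemma cost_direction:
  "mapu_cost b c d (w + e *\<^sub>R direction h) = mapu_cost b c d w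
    + e * (\<Sum>v\<in>UNIV. \<Sum>j\<in>UNIV. (if fst v then b (snd v) else c (snd v)) * d j * h v j)"
  unfolding cost_joint joint_direction
  by (simp add: sum.distrib sum_distrib_left distrib_left mult_ac)

text \<open>Otherwise \<open>w\<close> would be the midpoint of a proper segment with ends in
  \<open>S\<close>.\<close>

lemma extreme_point_of_line:
  fixes w u :: "'a::real_vector"
  assumes ext: "w extreme_point_of S" and e: "0 < e" and mem: "w + e *\<^sub>R u \<in> S" "w - e *\<^sub>R u \<in> S"
  shows "u = 0"
proof (rule ccontr)
  assume "u \<noteq> 0"
  then have ne: "w - e *\<^sub>R u \<noteq> w + e *\<^sub>R u"
    using e by (auto simp: neg_eq_iff_add_eq_0 scaleR_add_left[symmetric])
  have "midpoint (w - e *\<^sub>R u) (w + e *\<^sub>R u) = w"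
    by (simp add: midpoint_def scaleR_2[symmetric])
  then have "w \<in> open_segment (w - e *\<^sub>R u) (w + e *\<^sub>R u)"
    using ne by (metis midpoint_in_open_segment)
  then show False using ext mem by (auto simp: extreme_point_of_def)
qed

theorem theorem3p2:
  fixes b c :: "'i::finite \<Rightarrow> real"
    and d :: "'j::finite \<Rightarrow> real"
    and k :: nat
    and z :: "(real ^ ('i \<times> 'j)) \<times> (real ^ ('i \<times> 'j))"
  assumes "mapu_instance b c d k"
    and "inj b" and "inj c" and "range b \<inter> range c = {}"
    and "inj d"
    and "z extreme_point_of mapu_polytope k"
    and "mapu_optimal b c d k z"
  shows "integral_point z"
proof -
  define a where "a v = (if fst v then b (snd v) else c (snd v))" for v
  have z: "z \<in> mapu_polytope k" using assms(7) by (simp add: mapu_optimal_def)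
  note mem = z[unfolded mem_polytope_iff]
  have bc: "b i \<noteq> c i'" for i i' using assms(4) by auto
  \<comment> \<open>\<open>opt\<close> comes from comparing costs after a small feasible step,
    \<open>ext\<close> from extremality.\<close>
  interpret optimal_vertex "joint z" a d k
  proof
    show "inj a"
    proof (rule injI)
      fix v w assume "a v = a w"
      then show "v = w"
        using bc bc[symmetric] assms(2,3)
        by (cases v; cases w) (auto simp: a_def dest: injD split: if_splits)
    qed
    show "inj d" by fact
    show "0 \<le> d j" for j using assms(1) by (simp add: mapu_instance_def)
    show "a (True, i) < a (False, i)" for i
      using assms(1) bc[of i i] by (simp add: mapu_instance_def a_def less_le)
    show "0 \<le> joint z v j" for v j using mem by blast
    show "(\<Sum>v\<in>UNIV. joint z v j) = 1" for j using mem by simp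
    show "(\<Sum>j\<in>UNIV. joint z (True, i) j) + (\<Sum>j\<in>UNIV. joint z (False, i) j) = 1" for i
      using mem by simp
  next
    fix h :: "bool \<times> 'i \<Rightarrow> 'j \<Rightarrow> real"
    assume h: "\<And>j. (\<Sum>v\<in>UNIV. h v j) = 0"
      "\<And>i. (\<Sum>j\<in>UNIV. h (True, i) j) + (\<Sum>j\<in>UNIV. h (False, i) j) = 0"
      "\<And>v j. joint z v j = 0 \<Longrightarrow> 0 \<le> h v j"
      "(\<Sum>i\<in>UNIV. \<Sum>j\<in>UNIV. h (True, i) j) = 0"
    have "\<forall>\<^sub>F e in at_right 0. z + e *\<^sub>R direction h \<in> mapu_polytope k"
      using h by (intro eventually_feasible z) auto
    then have "\<forall>\<^sub>F e::real in at_right 0. 0 < e \<and> z + e *\<^sub>R direction h \<in> mapu_polytope k"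
      using eventually_at_right_less by (rule eventually_conj[rotated])
    then obtain e :: real where e: "0 < e" "z + e *\<^sub>R direction h \<in> mapu_polytope k"
      using eventually_happens'[OF trivial_limit_at_right_real] by blast
    have "mapu_cost b c d z \<le> mapu_cost b c d (z + e *\<^sub>R direction h)"
      using assms(7) e(2) by (simp add: mapu_optimal_def)
    then show "0 \<le> (\<Sum>v\<in>UNIV. \<Sum>j\<in>UNIV. a v * d j * h v j)"
      using e(1) by (simp add: cost_direction a_def zero_le_mult_iff)
  next
    fix h :: "bool \<times> 'i \<Rightarrow> 'j \<Rightarrow> real" and v j
    assume h: "\<And>j. (\<Sum>v\<in>UNIV. h v j) = 0"
      "\<And>i. (\<Sum>j\<in>UNIV. h (True, i) j) + (\<Sum>j\<in>UNIV. h (False, i) j) = 0"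
      "\<And>v j. joint z v j = 0 \<Longrightarrow> h v j = 0"
      "(\<Sum>i\<in>UNIV. \<Sum>j\<in>UNIV. joint z (True, i) j) = real k \<Longrightarrow> (\<Sum>i\<in>UNIV. \<Sum>j\<in>UNIV. h (True, i) j) = 0"
    have neg: "(\<Sum>j\<in>UNIV. - h (True, i) j) + (\<Sum>j\<in>UNIV. - h (False, i) j) = 0" for i
      using h(2)[of i] by (simp add: sum_negf)
    have "\<forall>\<^sub>F e in at_right 0. z + e *\<^sub>R direction h \<in> mapu_polytope k"
      using h by (intro eventually_feasible z) auto
    \<comment> \<open>Since \<open>h\<close> vanishes wherever \<open>joint z\<close> does, its
      negative meets the same sign condition, so small steps are feasible both ways.\<close>
    moreover have "\<forall>\<^sub>F e in at_right 0. z + e *\<^sub>R direction (\<lambda>v j. - h v j) \<in> mapu_polytope k"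
      by (intro eventually_feasible z neg) (simp_all add: sum_negf h)
    moreover have "\<forall>\<^sub>F e::real in at_right 0. 0 < e" by (rule eventually_at_right_less)
    ultimately have "\<forall>\<^sub>F e::real in at_right 0. 0 < e \<and> z + e *\<^sub>R direction h \<in> mapu_polytope k
        \<and> z + e *\<^sub>R direction (\<lambda>v j. - h v j) \<in> mapu_polytope k"
      by eventually_elim simp
    then obtain e :: real where e: "0 < e" "z + e *\<^sub>R direction h \<in> mapu_polytope k"
        "z + e *\<^sub>R direction (\<lambda>v j. - h v j) \<in> mapu_polytope k"
      using eventually_happens'[OF trivial_limit_at_right_real] by blast
    have "direction (\<lambda>v j. - h v j) = - direction h"
      by (simp add: direction_def vec_eq_iff)
    then have "direction h = 0"
      using extreme_point_of_line[OF assms(6) e(1,2)] e(3) by simp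
    then show "h v j = 0"
      by (cases v; cases "fst v") (auto simp: direction_def zero_prod_def vec_eq_iff)
  qed
  have "fst z $ (i, j) \<in> \<int>" "snd z $ (i, j) \<in> \<int>" for i j
    using integral[of "(True, i)" j] integral[of "(False, i)" j] by (simp_all add: joint_def)
  then show ?thesis by (cases z) (auto simp: integral_point_def)
qed

end
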